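(* There exists a constant $C>0$ such that for every $f\in C_B[0,\infty)$, all $0<q<p\leqslant 1$, every $x\in[0,\infty)$ and every integer $n>2$, $$|D_{n}^{p,q}(f,x)-f(x)|\leqslant\omega\left(f,|\mu_{n,1}^{p,q}(x)|\right)+C\,\omega_2\left(f,\sqrt{\mu_{n,2}^{p,q}(x)+\left(\mu_{n,1}^{p,q}(x)\right)^{2}}\,\right),$$ where $\mu_{n,i}^{p,q}(x)=D_n^{p,q}((t-x)^i,x)$, $i=1,2$, are the central moments of the $(p,q)$-Baskakov-Beta operators $D_n^{p,q}$.
   Context: Let $0<q<p\leqslant 1$. The $(p,q)$-numbers are $[n]_{p,q}=\frac{p^n-q^n}{p-q}$; $[n]_{p,q}!=\prod_{r=1}^n[r]_{p,q}$ for $n\geqslant 1$, $[0]_{p,q}!=1$; the $(p,q)$-binomial coefficient is $\begin{bmatrix} n\\ r\end{bmatrix}_{p,q}=\frac{[n]_{p,q}!}{[n-r]_{p,q}!\,[r]_{p,q}!}$ for $0\leqslant r\leqslant n$. The $(p,q)$-power basis is $(1\oplus y)_{p,q}^{N}=\prod_{i=0}^{N-1}(p^i+q^i y)$; in particular $(1\oplus pt)_{p,q}^{N}=\prod_{i=0}^{N-1}(p^i+p\,q^i t)$. The $(p,q)$-integral (generalized Jackson integral) is $\int_0^a f(x)\,d_{p,q}x=(p-q)a\sum_{i=0}^\infty\frac{q^i}{p^{i+1}}f\!\left(\frac{a q^i}{p^{i+1}}\right)$, and over $[0,\infty)$ it is $\int_0^\infty f(x)\,d_{p,q}x=(p-q)\sum_{i=-\infty}^{\infty}\frac{q^i}{p^{i+1}}f\!\left(\frac{q^i}{p^{i+1}}\right)$.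 For $m,n\in\mathbb{N}$ the $(p,q)$-Beta function of second kind is $B_{p,q}(m,n)=\int_0^\infty\frac{t^{m-1}}{(1\oplus pt)_{p,q}^{m+n}}\,d_{p,q}t$. The $(p,q)$-Baskakov basis functions are $$b_{n,k}^{p,q}(x)=\begin{bmatrix} n+k-1\\ k\end{bmatrix}_{p,q}p^{k+n(n-1)/2}\,q^{k(k-1)/2}\,\frac{x^k}{(1\oplus x)_{p,q}^{n+k}}.$$ The $(p,q)$-Baskakov-Beta operators are, for $n\in\mathbb{N}$ and $x\in[0,\infty)$, $$D_n^{p,q}(f,x)=\sum_{k=0}^\infty b_{n,k}^{p,q}(x)\,\frac{1}{B_{p,q}(k+1,n)}\int_0^\infty\frac{t^k}{(1\oplus pt)_{p,q}^{n+k+1}}\,f(q^2p^{n+k}t)\,d_{p,q}t.$$ $D_n^{p,q}((t-x)^i,x)$ means $D_n^{p,q}$ applied to the function $t\mapsto(t-x)^i$ (with $x$ fixed) and evaluated at $x$. $C_B[0,\infty)$ is the class of real-valued continuous bounded functions on $[0,\infty)$. For $f\in C_B[0,\infty)$ and $\delta\geqslant 0$, the $m$-th order modulus of continuity is $\omega_m(f,\delta)=\sup_{0\leqslant h\leqslant\delta}\sup_{x\in[0,\infty)}|\Delta_h^m f(x)|$, where $\Delta_h f(x)=f(x+h)-f(x)$ is the forward difference and $\Delta_h^m=\Delta_h(\Delta_h^{m-1})$; $\omega=\omega_1$. *)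

theory Defs
  imports "HOL-Analysis.Analysis"
begin

definition pq_num :: "real \<Rightarrow> real \<Rightarrow> nat \<Rightarrow> real" where
  "pq_num p q n = (p ^ n - q ^ n) / (p - q)"

definition pq_fact :: "real \<Rightarrow> real \<Rightarrow> nat \<Rightarrow> real" where
  "pq_fact p q n = (\<Prod>r = 1..n. pq_num p q r)"

text \<open>Only meaningful for \<open>r \<le> n\<close>, since \<open>n - r\<close> is truncated subtraction.\<close>

definition pq_binomial :: "real \<Rightarrow> real \<Rightarrow> nat \<Rightarrow> nat \<Rightarrow> real" where
  "pq_binomial p q n r = pq_fact p q n / (pq_fact p q (n - r) * pq_fact p q r)"

text \<open>The power basis \<open>(1 \<oplus> y)\<close> of degree \<open>N\<close>.\<close>

definition pq_power :: "real \<Rightarrow> real \<Rightarrow> nat \<Rightarrow> real \<Rightarrow> real" where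
  "pq_power p q N y = (\<Prod>i<N. p ^ i + q ^ i * y)"

text \<open>The Jackson integral over \<open>[0, \<infinity>)\<close>. The bilateral series is read as an unconditional
  (for reals: absolutely convergent) sum over the integers; as usual, \<open>infsum\<close> is \<open>0\<close> if the
  sum does not exist.\<close>

definition pq_integral :: "real \<Rightarrow> real \<Rightarrow> (real \<Rightarrow> real) \<Rightarrow> real" where
  "pq_integral p q f =
     (p - q) * (\<Sum>\<^sub>\<infinity>i\<in>(UNIV :: int set).
                  q powi i / p powi (i + 1) * f (q powi i / p powi (i + 1)))"

text \<open>The Beta function of second kind, for \<open>m, n \<ge> 1\<close>.\<close>

definition pq_Beta :: "real \<Rightarrow> real \<Rightarrow> nat \<Rightarrow> nat \<Rightarrow> real" where
  "pq_Beta p q m n = pq_integral p q (\<lambda>t. t ^ (m - 1) / pq_power p q (m + n) (p * t))"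

definition baskakov_basis :: "real \<Rightarrow> real \<Rightarrow> nat \<Rightarrow> nat \<Rightarrow> real \<Rightarrow> real" where
  "baskakov_basis p q n k x =
     pq_binomial p q (n + k - 1) k * p ^ (k + n * (n - 1) div 2) * q ^ (k * (k - 1) div 2)
       * (x ^ k / pq_power p q (n + k) x)"

definition baskakov_beta :: "real \<Rightarrow> real \<Rightarrow> nat \<Rightarrow> (real \<Rightarrow> real) \<Rightarrow> real \<Rightarrow> real" where
  "baskakov_beta p q n f x =
     (\<Sum>k. baskakov_basis p q n k x * (1 / pq_Beta p q (k + 1) n)
            * pq_integral p q (\<lambda>t. t ^ k / pq_power p q (n + k + 1) (p * t)
                                     * f (q\<^sup>2 * p ^ (n + k) * t)))"

definition central_moment :: "real \<Rightarrow> real \<Rightarrow> nat \<Rightarrow> nat \<Rightarrow> real \<Rightarrow> real" where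
  "central_moment p q n i x = baskakov_beta p q n (\<lambda>t. (t - x) ^ i) x"

text \<open>Functions on \<open>[0, \<infinity>)\<close> are total functions whose values at negative arguments are
  irrelevant.\<close>

definition C_B :: "(real \<Rightarrow> real) set" where
  "C_B = {f. continuous_on {0..} f \<and> bounded (f ` {0..})}"

definition fwd_diff :: "real \<Rightarrow> (real \<Rightarrow> real) \<Rightarrow> real \<Rightarrow> real" where
  "fwd_diff h f x = f (x + h) - f x"

text \<open>The suprema are over nonempty sets that are bounded above when \<open>f \<in> C_B\<close> and
  \<open>\<delta> \<ge> 0\<close>.\<close>

definition modulus :: "nat \<Rightarrow> (real \<Rightarrow> real) \<Rightarrow> real \<Rightarrow> real" where
  "modulus m f \<delta> = (SUP h\<in>{0..\<delta>}. SUP x\<in>{0..}. \<bar>(fwd_diff h ^^ m) f x\<bar>)"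

end

theory Submission
  imports Defs
begin

text \<open>
  The operator is an expectation \<open>f \<mapsto> E (f U)\<close> for a discrete probability law on \<open>[0, \<infinity>)\<close>:
  both the basis functions in \<open>k\<close> and, for fixed \<open>k\<close>, the normalised Jackson weights sum to \<open>1\<close>,
  and \<open>n > 2\<close> makes the second moment finite. Put \<open>m = E U = x + \<mu>\<^sub>1\<close>, so that the variance
  \<open>\<mu>\<^sub>2 - \<mu>\<^sub>1\<^sup>2\<close> is at most \<open>\<delta>\<^sup>2 = \<mu>\<^sub>2 + \<mu>\<^sub>1\<^sup>2\<close>. Moving from \<open>f x\<close> to \<open>f m\<close> costs
  \<open>\<omega>(f, \<bar>\<mu>\<^sub>1\<bar>)\<close>. For the rest, some affine function through \<open>(m, f m)\<close> approximates \<open>f\<close> with error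
  at most \<open>(8 + 2 (u - m)\<^sup>2 / \<delta>\<^sup>2) \<omega>\<^sub>2(f, \<delta>)\<close> at every \<open>u \<ge> 0\<close>; the expectation kills the linear
  part, which leaves \<open>10 \<omega>\<^sub>2(f, \<delta>)\<close>. The affine function interpolates \<open>f\<close> at \<open>m\<close> and
  \<open>m + 2 \<delta>\<close>: between these points the error is at most \<open>\<omega>\<^sub>2(f, \<delta>)\<close> by considering where it is
  maximal, and it then grows quadratically in the number of steps of length \<open>\<delta>\<close>.
\<close>

section \<open>Affine approximation and the second modulus of continuity\<close>

text \<open>At a point \<open>z\<close> where |g| is maximal, reflect the nearer endpoint in
  \<open>z\<close>. The second difference centred at \<open>z\<close> then has step at most
  \<open>d\<close>; the endpoint contributes 0 and the reflected point at most |g z|, so 2 |g z| -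
  |g z| is at most \<open>W\<close>.\<close>

lemma whitney_two_steps:
  fixes g :: "real \<Rightarrow> real"
  assumes d: "d > 0" and cont: "continuous_on {a..a + 2 * d} g"
    and ends: "g a = 0" "g (a + 2 * d) = 0"
    and diff: "\<And>y h. \<lbrakk>a \<le> y; 0 \<le> h; h \<le> d; y + 2 * h \<le> a + 2 * d\<rbrakk>
      \<Longrightarrow> \<bar>g (y + 2 * h) - 2 * g (y + h) + g y\<bar> \<le> W"
    and u: "a \<le> u" "u \<le> a + 2 * d"
  shows "\<bar>g u\<bar> \<le> W"
proof -
  have "continuous_on {a..a + 2 * d} (\<lambda>y. \<bar>g y\<bar>)"
    using cont by (intro continuous_intros)
  then obtain z where z: "a \<le> z" "z \<le> a + 2 * d"
    and zmax: "\<And>y. a \<le> y \<Longrightarrow> y \<le> a + 2 * d \<Longrightarrow> \<bar>g y\<bar> \<le> \<bar>g z\<bar>"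
    using continuous_attains_sup[of "{a..a + 2 * d}" "\<lambda>y. \<bar>g y\<bar>"] d by fastforce
  have "\<bar>g z\<bar> \<le> W"
  proof (cases "z \<le> a + d")
    case True
    have "\<bar>g (2 * z - a)\<bar> \<le> \<bar>g z\<bar>" using zmax[of "2 * z - a"] z True by auto
    moreover have "\<bar>g (2 * z - a) - 2 * g z\<bar> \<le> W"
      using diff[of a "z - a"] ends z True by (simp add: algebra_simps)
    ultimately show ?thesis by linarith
  next
    case False
    have "\<bar>g (2 * z - (a + 2 * d))\<bar> \<le> \<bar>g z\<bar>"
      using zmax[of "2 * z - (a + 2 * d)"] z False by auto
    moreover have "\<bar>- 2 * g z + g (2 * z - (a + 2 * d))\<bar> \<le> W"
      using diff[of "2 * z - (a + 2 * d)" "a + 2 * d - z"] ends z False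
      by (simp add: algebra_simps)
    ultimately show ?thesis by linarith
  qed
  with zmax[OF u] show ?thesis by simp
qed

text \<open>Both claims run through one induction. A second difference is a difference of first
  differences, so the bound on first differences of step \<open>d\<close> grows by \<open>W\<close>
  with each step away from the base interval, and accumulating these bounds makes the values grow
  quadratically. The range for first differences ends \<open>d\<close> earlier on the right, so that
  \<open>u + d\<close> stays in the range for values.\<close>

lemma quadratic_growth_step:
  fixes g :: "real \<Rightarrow> real"
  assumes d: "d > 0" and a: "a \<ge> 0"
    and diff: "\<And>y. y \<ge> 0 \<Longrightarrow> \<bar>g (y + 2 * d) - 2 * g (y + d) + g y\<bar> \<le> W"
    and base: "\<And>u. a \<le> u \<Longrightarrow> u \<le> a + 2 * d \<Longrightarrow> \<bar>g u\<bar> \<le> W"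
  shows "(\<forall>u\<ge>0. a - real j * d \<le> u \<longrightarrow> u \<le> a + real j * d + 2 * d \<longrightarrow> \<bar>g u\<bar> \<le> (real j + 1)\<^sup>2 * W)
    \<and> (\<forall>u\<ge>0. a - real j * d \<le> u \<longrightarrow> u \<le> a + real j * d + d \<longrightarrow>
         \<bar>g (u + d) - g u\<bar> \<le> (real j + 2) * W)"
proof (induction j)
  case 0
  have "\<bar>g (u + d) - g u\<bar> \<le> 2 * W" if "a \<le> u" "u \<le> a + d" for u
    using base[of u] base[of "u + d"] that d by linarith
  with base show ?case by simp
next
  case (Suc j)
  define e where "e = real j * d"
  define G where "G = (real j + 1)\<^sup>2 * W"
  define D where "D = (real j + 2) * W"
  have W: "W \<ge> 0" using base[of a] d by linarith
  have e: "e \<ge> 0" "real (Suc j) * d = e + d" using d by (simp_all add: e_def algebra_simps)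
  have D: "D \<ge> 0" "(real (Suc j) + 2) * W = D + W" using W by (simp_all add: D_def algebra_simps)
  \<comment> \<open>One more step adds at most the new difference bound \<open>D + W\<close> to the
    old value bound; the slack is \<open>j * W\<close>.\<close>
  have "G + (D + W) \<le> (real (Suc j) + 1)\<^sup>2 * W"
  proof -
    have "(real j + 1)\<^sup>2 + (real j + 3) \<le> (real (Suc j) + 1)\<^sup>2"
      by (simp add: power2_eq_square algebra_simps)
    from mult_right_mono[OF this W] show ?thesis by (simp add: G_def D_def algebra_simps)
  qed
  then obtain G' where G': "G + (D + W) \<le> G'" "G' = (real (Suc j) + 1)\<^sup>2 * W" by blast
  have IHg: "\<bar>g u\<bar> \<le> G" if "u \<ge> 0" "a - e \<le> u" "u \<le> a + e + 2 * d" for u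
    using Suc.IH that unfolding e_def G_def by blast
  have IHd: "\<bar>g (u + d) - g u\<bar> \<le> D" if "u \<ge> 0" "a - e \<le> u" "u \<le> a + e + d" for u
    using Suc.IH that unfolding e_def D_def by blast
  have B: "\<bar>g (u + d) - g u\<bar> \<le> D + W"
    if u: "u \<ge> 0" "a - (e + d) \<le> u" "u \<le> a + (e + d) + d" for u
  proof -
    consider "u < a - e" | "a - e \<le> u" "u \<le> a + e + d" | "u > a + e + d" by linarith
    then show ?thesis
    proof cases
      case 1
      \<comment> \<open>Left of the old range the increment is compared with the one starting at
        \<open>u + d\<close>; right of it, in the third case, with the one starting at
        \<open>u - d\<close>, which is nonnegative there because \<open>u\<close> exceeds
        \<open>a + d\<close>.\<close>
      have "\<bar>g (u + d + d) - g (u + d)\<bar> \<le> D"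
        using u 1 d e by (intro IHd; linarith)
      then have "\<bar>g (u + 2 * d) - g (u + d)\<bar> \<le> D"
        by (simp only: add.assoc mult_2)
      then show ?thesis using diff[OF u(1)] by linarith
    next
      case 2
      then show ?thesis using IHd[OF u(1) 2] W by linarith
    next
      case 3
      then have "\<bar>g (u - d + d) - g (u - d)\<bar> \<le> D"
        using u d a e by (intro IHd; linarith)
      then have "\<bar>g u - g (u - d)\<bar> \<le> D" by simp
      moreover have "\<bar>g (u + d) - 2 * g u + g (u - d)\<bar> \<le> W"
        using diff[of "u - d"] 3 a e by (simp add: algebra_simps)
      ultimately show ?thesis by linarith
    qed
  qed
  have A: "\<bar>g u\<bar> \<le> G'"
    if u: "u \<ge> 0" "a - (e + d) \<le> u" "u \<le> a + (e + d) + 2 * d" for u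
  proof -
    consider "u < a - e" | "a - e \<le> u" "u \<le> a + e + 2 * d" | "u > a + e + 2 * d" by linarith
    then show ?thesis
    proof cases
      case 1
      have "\<bar>g (u + d)\<bar> \<le> G"
        using u 1 d e by (intro IHg; linarith)
      moreover have "\<bar>g (u + d) - g u\<bar> \<le> D + W"
        using u 1 d e by (intro B; linarith)
      ultimately show ?thesis using G' by linarith
    next
      case 2
      then show ?thesis using IHg[OF u(1) 2] G' D W by linarith
    next
      case 3
      have "\<bar>g (u - d)\<bar> \<le> G"
        using u 3 d a e by (intro IHg; linarith)
      moreover have "\<bar>g (u - d + d) - g (u - d)\<bar> \<le> D + W"
        using u 3 d a e by (intro B; linarith)
      moreover have "u - d + d = u" by simp
      ultimately show ?thesis using G' by auto
    qed
  qed
  from A B show ?case unfolding e(2) D(2) G'(2)[symmetric] by blast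
qed

text \<open>The second interpolation point lies to the right of \<open>m\<close>, which stays in the
  half-line even for \<open>m = 0\<close>. Second differences vanish on affine functions, so
  \<open>g\<close> inherits the bound assumed for \<open>f\<close> and the two preceding lemmas
  apply to it.\<close>

lemma affine_approximation:
  fixes f :: "real \<Rightarrow> real"
  assumes d: "d > 0" and m: "m \<ge> 0" and cont: "continuous_on {0..} f"
    and diff: "\<And>y h. \<lbrakk>0 \<le> y; 0 \<le> h; h \<le> d\<rbrakk>
      \<Longrightarrow> \<bar>f (y + 2 * h) - 2 * f (y + h) + f y\<bar> \<le> W"
  obtains c where
    "\<And>u. u \<ge> 0 \<Longrightarrow> \<bar>f u - f m - c * (u - m)\<bar> \<le> (8 + 2 * (u - m)\<^sup>2 / d\<^sup>2) * W"
proof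
  define c where "c = (f (m + 2 * d) - f m) / (2 * d)"
  define g where "g = (\<lambda>u. f u - f m - c * (u - m))"
  have gdiff: "\<bar>g (y + 2 * h) - 2 * g (y + h) + g y\<bar> \<le> W" if "0 \<le> y" "0 \<le> h" "h \<le> d" for y h
  proof -
    have "g (y + 2 * h) - 2 * g (y + h) + g y = f (y + 2 * h) - 2 * f (y + h) + f y"
      by (simp add: g_def algebra_simps)
    with diff[OF that] show ?thesis by simp
  qed
  have base: "\<bar>g u\<bar> \<le> W" if "m \<le> u" "u \<le> m + 2 * d" for u
  proof (rule whitney_two_steps[OF d _ _ _ _ that])
    show "continuous_on {m..m + 2 * d} g"
      unfolding g_def using m
      by (intro continuous_intros continuous_on_subset[OF cont]) auto
    show "g m = 0" by (simp add: g_def)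
    show "g (m + 2 * d) = 0" using d by (simp add: g_def c_def)
  qed (use gdiff m in auto)
  have W: "W \<ge> 0" using base[of m] d by linarith
  fix u :: real assume u: "u \<ge> 0"
  \<comment> \<open>The distance in units of \<open>d\<close>, rounded up to \<open>j\<close>, which
    is at most v + 1. The constants 8 and 2 come from (j + 1)^2 \<le> (v + 2)^2 \<le> 8 + 2 v^2,
    where the last step is 4 v \<le> v^2 + 4.\<close>
  define v where "v = \<bar>u - m\<bar> / d"
  define j where "j = nat \<lceil>v\<rceil>"
  have v: "v \<ge> 0" using d by (simp add: v_def)
  have j: "v \<le> real j" "real j \<le> v + 1" using v unfolding j_def by linarith+
  have "\<bar>u - m\<bar> = v * d" using d by (simp add: v_def)
  also have "\<dots> \<le> real j * d" using j d by simp
  finally have jd: "\<bar>u - m\<bar> \<le> real j * d" .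
  have "\<bar>g u\<bar> \<le> (real j + 1)\<^sup>2 * W"
  proof -
    have "a - real j * d \<le> u \<and> u \<le> a + real j * d + 2 * d" if "a = m" for a
      using jd d that by linarith
    then show ?thesis
      using quadratic_growth_step[of d m g W j, OF d m gdiff[of _ d] base] u d by auto
  qed
  also have "\<dots> \<le> (8 + 2 * v\<^sup>2) * W"
  proof (rule mult_right_mono[OF _ W])
    have "(real j + 1)\<^sup>2 \<le> (v + 2)\<^sup>2" using j v by (intro power_mono) auto
    also have "\<dots> \<le> 8 + 2 * v\<^sup>2"
      using sum_squares_bound[of v 2] by (simp add: power2_eq_square algebra_simps)
    finally show "(real j + 1)\<^sup>2 \<le> 8 + 2 * v\<^sup>2" .
  qed
  also have "v\<^sup>2 = (u - m)\<^sup>2 / d\<^sup>2" by (simp add: v_def power_divide)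
  finally show "\<bar>f u - f m - c * (u - m)\<bar> \<le> (8 + 2 * (u - m)\<^sup>2 / d\<^sup>2) * W"
    by (simp add: g_def)
qed

section \<open>Finite differences and the moduli of continuity\<close>

text \<open>Each further difference at most doubles a uniform bound. This provides the boundedness
  on which the suprema in \<open>modulus\<close> depend.\<close>

lemma fwd_diff_iterate_bound:
  assumes "\<And>y. y \<ge> 0 \<Longrightarrow> \<bar>f y\<bar> \<le> M" and "h \<ge> 0" "y \<ge> 0"
  shows "\<bar>(fwd_diff h ^^ m) f y\<bar> \<le> 2 ^ m * M"
  using assms(3)
proof (induction m arbitrary: y)
  case 0
  then show ?case using assms by simp
next
  case (Suc m)
  have "\<bar>(fwd_diff h ^^ m) f (y + h)\<bar> \<le> 2 ^ m * M" "\<bar>(fwd_diff h ^^ m) f y\<bar> \<le> 2 ^ m * M"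
    using Suc assms(2) by auto
  then show ?case by (simp add: fwd_diff_def[of h "(fwd_diff h ^^ m) f"])
qed

text \<open>A real supremum is sure to dominate its members once the set is bounded above. This is
  checked for both nested suprema, with the common bound \<open>2 ^ m * M\<close>.\<close>

lemma fwd_diff_le_modulus:
  assumes f: "f \<in> C_B" and h: "0 \<le> h" "h \<le> \<delta>" and y: "0 \<le> y"
  shows "\<bar>(fwd_diff h ^^ m) f y\<bar> \<le> modulus m f \<delta>"
proof -
  obtain M where "\<forall>y\<in>{0..}. \<bar>f y\<bar> \<le> M"
    using f by (auto simp: C_B_def bounded_iff)
  then have M: "\<bar>f y\<bar> \<le> M" if "y \<ge> 0" for y
    using that by simp
  have b: "\<bar>(fwd_diff h ^^ m) f y\<bar> \<le> 2 ^ m * M" if "h \<ge> 0" "y \<ge> 0" for h y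
    by (rule fwd_diff_iterate_bound[OF M that])
  have inner: "bdd_above ((\<lambda>x. \<bar>(fwd_diff h ^^ m) f x\<bar>) ` {0..})" if "h \<ge> 0" for h
    by (rule bdd_aboveI2[where M="2 ^ m * M"]) (simp add: b that)
  have "\<bar>(fwd_diff h ^^ m) f y\<bar> \<le> (SUP x\<in>{0..}. \<bar>(fwd_diff h ^^ m) f x\<bar>)"
    by (rule cSUP_upper[OF _ inner[OF h(1)]]) (simp add: y)
  also have "\<dots> \<le> modulus m f \<delta>"
    unfolding modulus_def
  proof (rule cSUP_upper)
    show "bdd_above ((\<lambda>h. SUP x\<in>{0..}. \<bar>(fwd_diff h ^^ m) f x\<bar>) ` {0..\<delta>})"
    proof (rule bdd_aboveI2)
      fix h assume "h \<in> {0..\<delta>}"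
      then show "(SUP x\<in>{0..}. \<bar>(fwd_diff h ^^ m) f x\<bar>) \<le> 2 ^ m * M"
        by (intro cSUP_least) (simp_all add: b)
    qed
  qed (simp add: h)
  finally show ?thesis .
qed

text \<open>The increment is taken from the smaller of the two points, since \<open>modulus\<close>
  ranges over forward steps.\<close>

lemma increment_le_modulus:
  assumes "f \<in> C_B" "x \<ge> 0" "y \<ge> 0"
  shows "\<bar>f y - f x\<bar> \<le> modulus 1 f \<bar>y - x\<bar>"
proof (cases "x \<le> y")
  case True
  then show ?thesis
    using fwd_diff_le_modulus[OF assms(1), of "y - x" "\<bar>y - x\<bar>" x 1] assms by (simp add: fwd_diff_def)
next
  case False
  then show ?thesis
    using fwd_diff_le_modulus[OF assms(1), of "x - y" "\<bar>y - x\<bar>" y 1] assms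
    by (simp add: fwd_diff_def abs_minus_commute)
qed

lemma second_difference_le_modulus:
  assumes "f \<in> C_B" "0 \<le> h" "h \<le> \<delta>" "0 \<le> y"
  shows "\<bar>f (y + 2 * h) - 2 * f (y + h) + f y\<bar> \<le> modulus 2 f \<delta>"
proof -
  have "(fwd_diff h ^^ 2) f y = f (y + 2 * h) - 2 * f (y + h) + f y"
  proof -
    have "(fwd_diff h ^^ 2) f y = fwd_diff h (fwd_diff h f) y"
      by (simp add: numeral_2_eq_2)
    also have "\<dots> = f (y + h + h) - f (y + h) - (f (y + h) - f y)"
      by (simp only: fwd_diff_def)
    also have "y + h + h = y + 2 * h" by simp
    finally show ?thesis by simp
  qed
  then show ?thesis using fwd_diff_le_modulus[OF assms, of 2] by simp
qed

section \<open>Approximation error of a discrete probability law\<close>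

lemma has_sum_diff_real:
  fixes f g :: "'a \<Rightarrow> real"
  assumes "(f has_sum a) A" "(g has_sum b) A"
  shows "((\<lambda>x. f x - g x) has_sum a - b) A"
proof -
  have "((\<lambda>x. - g x) has_sum - b) A" using assms(2) by (simp add: has_sum_uminus)
  from has_sum_add[OF assms(1) this] show ?thesis by simp
qed

text \<open>The index type is arbitrary so that the double sum over \<open>k\<close> and the Jackson
  index can enter as one law on pairs. Positivity of \<mu>2 makes \<open>d\<close> positive, so that
  the affine approximation with step \<open>d\<close> is available.\<close>

lemma weighted_mean_bound:
  fixes w u :: "'a \<Rightarrow> real"
  assumes f: "f \<in> C_B" and x: "x \<ge> 0"
    and w: "\<And>j. w j \<ge> 0" "(w has_sum 1) UNIV" and u: "\<And>j. u j \<ge> 0"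
    and F: "((\<lambda>j. w j * f (u j)) has_sum F) UNIV"
    and mu1: "((\<lambda>j. w j * (u j - x)) has_sum \<mu>1) UNIV"
    and mu2: "((\<lambda>j. w j * (u j - x)\<^sup>2) has_sum \<mu>2) UNIV" "\<mu>2 > 0"
  shows "\<bar>F - f x\<bar> \<le> modulus 1 f \<bar>\<mu>1\<bar> + 10 * modulus 2 f (sqrt (\<mu>2 + \<mu>1\<^sup>2))"
proof -
  define m where "m = x + \<mu>1"
  define d where "d = sqrt (\<mu>2 + \<mu>1\<^sup>2)"
  define W where "W = modulus 2 f d"
  have V: "\<mu>2 + \<mu>1\<^sup>2 > 0" using mu2(2) by (simp add: add_pos_nonneg)
  then have d: "d > 0" "d\<^sup>2 = \<mu>2 + \<mu>1\<^sup>2" by (simp_all add: d_def)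
  have "((\<lambda>j. w j * (u j - x) + x * w j) has_sum \<mu>1 + x * 1) UNIV"
    by (intro has_sum_add has_sum_cmult_right mu1 w)
  then have mean: "((\<lambda>j. w j * u j) has_sum m) UNIV"
    by (simp add: m_def algebra_simps)
  then have m: "m \<ge> 0" by (rule has_sum_nonneg) (simp add: w u)
  have W: "W \<ge> 0"
    using second_difference_le_modulus[OF f, of 0 d 0] d unfolding W_def by simp
  have cont: "continuous_on {0..} f" using f by (simp add: C_B_def)
  obtain c where c: "\<bar>f u - f m - c * (u - m)\<bar> \<le> (8 + 2 * (u - m)\<^sup>2 / d\<^sup>2) * W"
    if "u \<ge> 0" for u
    using affine_approximation[OF d(1) m cont second_difference_le_modulus[OF f]]
    unfolding W_def by blast
  \<comment> \<open>The slope term sums to zero because \<open>m\<close> is the mean, so subtracting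
    the affine function changes the sum by \<open>f m\<close> alone.\<close>
  have "((\<lambda>j. w j * f (u j) - f m * w j - c * (w j * u j - m * w j))
      has_sum F - f m * 1 - c * (m - m * 1)) UNIV"
    by (intro has_sum_diff_real has_sum_cmult_right F w mean)
  then have dev: "((\<lambda>j. w j * (f (u j) - f m - c * (u j - m))) has_sum F - f m) UNIV"
    by (simp add: algebra_simps)
  have "((\<lambda>j. w j * (u j - x)\<^sup>2 - 2 * \<mu>1 * (w j * (u j - x)) + \<mu>1\<^sup>2 * w j)
      has_sum \<mu>2 - 2 * \<mu>1 * \<mu>1 + \<mu>1\<^sup>2 * 1) UNIV"
    by (intro has_sum_diff_real has_sum_add has_sum_cmult_right mu1 mu2 w)
  also have "(\<lambda>j. w j * (u j - x)\<^sup>2 - 2 * \<mu>1 * (w j * (u j - x)) + \<mu>1\<^sup>2 * w j)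
      = (\<lambda>j. w j * (u j - m)\<^sup>2)"
    by (simp add: m_def power2_eq_square algebra_simps)
  finally have var: "((\<lambda>j. w j * (u j - m)\<^sup>2) has_sum \<mu>2 - \<mu>1\<^sup>2) UNIV"
    by (simp add: power2_eq_square)
  have "((\<lambda>j. (8 * W) * w j + (2 * W / d\<^sup>2) * (w j * (u j - m)\<^sup>2))
      has_sum (8 * W) * 1 + (2 * W / d\<^sup>2) * (\<mu>2 - \<mu>1\<^sup>2)) UNIV"
    by (intro has_sum_add has_sum_cmult_right w var)
  also have "(\<lambda>j. (8 * W) * w j + (2 * W / d\<^sup>2) * (w j * (u j - m)\<^sup>2))
      = (\<lambda>j. w j * ((8 + 2 * (u j - m)\<^sup>2 / d\<^sup>2) * W))"
    by (simp add: algebra_simps)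
  finally have bound: "((\<lambda>j. w j * ((8 + 2 * (u j - m)\<^sup>2 / d\<^sup>2) * W))
      has_sum (8 * W) + (2 * W / d\<^sup>2) * (\<mu>2 - \<mu>1\<^sup>2)) UNIV" by simp
  have le: "w j * \<bar>f (u j) - f m - c * (u j - m)\<bar> \<le> w j * ((8 + 2 * (u j - m)\<^sup>2 / d\<^sup>2) * W)" for j
    by (rule mult_left_mono[OF c[OF u] w(1)])
  have dev': "((\<lambda>j. - (w j * (f (u j) - f m - c * (u j - m)))) has_sum - (F - f m)) UNIV"
    using dev by (subst has_sum_uminus) simp
  have "F - f m \<le> (8 * W) + (2 * W / d\<^sup>2) * (\<mu>2 - \<mu>1\<^sup>2)"
  proof (rule has_sum_mono[OF dev bound])
    show "w j * (f (u j) - f m - c * (u j - m)) \<le> w j * ((8 + 2 * (u j - m)\<^sup>2 / d\<^sup>2) * W)" for j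
      by (rule order_trans[OF mult_left_mono[OF abs_ge_self w(1)] le])
  qed
  moreover have "- (F - f m) \<le> (8 * W) + (2 * W / d\<^sup>2) * (\<mu>2 - \<mu>1\<^sup>2)"
  proof (rule has_sum_mono[OF dev' bound])
    show "- (w j * (f (u j) - f m - c * (u j - m))) \<le> w j * ((8 + 2 * (u j - m)\<^sup>2 / d\<^sup>2) * W)" for j
      unfolding mult_minus_right[symmetric]
      by (rule order_trans[OF mult_left_mono[OF abs_ge_minus_self w(1)] le])
  qed
  \<comment> \<open>The variance is at most \<open>d\<^sup>2\<close>, so the quadratic part of the
    error costs at most 2 W; together with 8 W this is the constant 10.\<close>
  moreover have "(2 * W / d\<^sup>2) * (\<mu>2 - \<mu>1\<^sup>2) \<le> (2 * W / d\<^sup>2) * d\<^sup>2"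
  proof (rule mult_left_mono)
    show "\<mu>2 - \<mu>1\<^sup>2 \<le> d\<^sup>2" by (simp add: d(2))
    show "0 \<le> 2 * W / d\<^sup>2" using W by simp
  qed
  moreover have "(2 * W / d\<^sup>2) * d\<^sup>2 = 2 * W" using d(1) by simp
  ultimately have "\<bar>F - f m\<bar> \<le> 10 * W" by linarith
  moreover have "\<bar>f m - f x\<bar> \<le> modulus 1 f \<bar>\<mu>1\<bar>"
    using increment_le_modulus[OF f x m] by (simp add: m_def)
  ultimately show ?thesis by (simp add: W_def d_def)
qed

section \<open>The Baskakov basis\<close>

locale pq_parameters =
  fixes p q :: real
  assumes q_pos: "0 < q" and q_less: "q < p" and p_le: "p \<le> 1"
begin

section \<open>Arithmetic of (p,q)-numbers and of the power basis\<close>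

lemma p_pos: "0 < p"
  using q_pos q_less by simp

lemma ratio: "0 < q / p" "q / p < 1"
  using q_pos q_less p_pos by simp_all

lemma pq_num_pos: "n > 0 \<Longrightarrow> pq_num p q n > 0"
  unfolding pq_num_def using q_pos q_less by (simp add: power_strict_mono)

lemma pq_num_nonneg: "pq_num p q n \<ge> 0"
  unfolding pq_num_def using q_pos q_less by (simp add: power_mono)

lemma pq_num_1 [simp]: "pq_num p q (Suc 0) = 1"
  unfolding pq_num_def using q_less by simp

lemma pq_num_add: "pq_num p q (a + b) = p ^ b * pq_num p q a + q ^ a * pq_num p q b"
  by (simp add: pq_num_def power_add add_divide_distrib[symmetric] algebra_simps)

lemma pq_fact_Suc: "pq_fact p q (Suc n) = pq_fact p q n * pq_num p q (Suc n)"
  by (simp add: pq_fact_def)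

lemma pq_fact_pos: "pq_fact p q n > 0"
  unfolding pq_fact_def by (intro prod_pos) (simp add: pq_num_pos)

lemma pq_power_Suc: "pq_power p q (Suc N) y = pq_power p q N y * (p ^ N + q ^ N * y)"
  by (simp add: pq_power_def)

lemma pq_power_pos: "y \<ge> 0 \<Longrightarrow> pq_power p q N y > 0"
  unfolding pq_power_def using p_pos q_pos by (intro prod_pos) (simp add: add_pos_nonneg)

text \<open>The factor of index i + 1 is p times the factor of index i at (q/p) y. The identity
  serves the shift of a Jackson index by one, which multiplies the argument by q/p.\<close>

lemma pq_power_scale: "pq_power p q (Suc N) y = (1 + y) * p ^ N * pq_power p q N (q / p * y)"
proof (induction N)
  case 0
  then show ?case by (simp add: pq_power_def)
next
  case (Suc N)
  have "p ^ Suc N + q ^ Suc N * y = p * (p ^ N + q ^ N * (q / p * y))"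
    using p_pos by (simp add: field_simps)
  then have "pq_power p q (Suc (Suc N)) y
      = ((1 + y) * p ^ N * pq_power p q N (q / p * y)) * (p * (p ^ N + q ^ N * (q / p * y)))"
    by (simp only: pq_power_Suc[of "Suc N"] Suc.IH)
  also have "\<dots> = (1 + y) * p ^ Suc N * pq_power p q (Suc N) (q / p * y)"
    by (simp only: pq_power_Suc power_Suc mult_ac)
  finally show ?case .
qed

section \<open>Recurrences of the basis functions in the index and in the order\<close>

text \<open>Writing the order as \<open>Suc m\<close> removes the truncated subtractions: the
  binomial coefficient becomes that of m + k over k.\<close>

lemma baskakov_basis_Suc:
  "baskakov_basis p q (Suc m) k x =
     pq_fact p q (m + k) / (pq_fact p q m * pq_fact p q k) * p ^ (k + Suc m * m div 2)
       * q ^ (k * (k - 1) div 2) * (x ^ k / pq_power p q (Suc (m + k)) x)"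
  by (simp add: baskakov_basis_def pq_binomial_def)

lemma baskakov_basis_nonneg: "x \<ge> 0 \<Longrightarrow> baskakov_basis p q (Suc m) k x \<ge> 0"
  unfolding baskakov_basis_Suc using p_pos q_pos
  by (intro mult_nonneg_nonneg divide_nonneg_nonneg) (auto intro: less_imp_le pq_fact_pos pq_power_pos)

lemma baskakov_basis_0_pos: "baskakov_basis p q (Suc m) 0 x > 0" if "x \<ge> 0"
  unfolding baskakov_basis_Suc using p_pos q_pos
  by (intro mult_pos_pos divide_pos_pos pq_fact_pos pq_power_pos that) simp_all

lemma triangular_Suc: "Suc k * k div 2 = k * (k - 1) div 2 + k" for k :: nat
  by (cases k) simp_all

text \<open>The quotient of consecutive basis functions, cross-multiplied. The factor p^(m+k+1) +
  q^(m+k+1) x is the new factor of the power basis, and q^k comes from the triangular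
  exponent.\<close>

lemma baskakov_basis_step:
  assumes x: "x \<ge> 0"
  shows "baskakov_basis p q (Suc m) (Suc k) x * (pq_num p q (Suc k) * (p ^ Suc (m + k) + q ^ Suc (m + k) * x))
    = baskakov_basis p q (Suc m) k x * (pq_num p q (Suc (m + k)) * p * q ^ k * x)"
proof -
  define T where "T = q ^ (k * (k - 1) div 2)"
  define D where "D = p ^ Suc (m + k) + q ^ Suc (m + k) * x"
  define P where "P = pq_power p q (Suc (m + k)) x"
  have "D > 0" unfolding D_def using p_pos q_pos x by (intro add_pos_nonneg) auto
  moreover have "P > 0" unfolding P_def by (rule pq_power_pos[OF x])
  moreover have "pq_fact p q m > 0" "pq_fact p q k > 0" "pq_num p q (Suc k) > 0"
    by (simp_all add: pq_fact_pos pq_num_pos)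
  moreover have "q ^ (Suc k * (Suc k - 1) div 2) = T * q ^ k"
    using triangular_Suc[of k] by (simp add: T_def power_add)
  moreover have "pq_power p q (Suc (m + Suc k)) x = P * D"
    using pq_power_Suc[of "Suc (m + k)" x] by (simp add: P_def D_def)
  moreover have "pq_fact p q (m + Suc k) = pq_fact p q (m + k) * pq_num p q (Suc (m + k))"
    using pq_fact_Suc[of "m + k"] by simp
  ultimately show ?thesis
    unfolding baskakov_basis_Suc pq_fact_Suc[of k]
    unfolding D_def[symmetric] P_def[symmetric] T_def[symmetric]
    by (simp add: field_simps power_add)
qed

text \<open>The analogous quotient for raising the order. It shares its power basis factor with
  \<open>baskakov_basis_step\<close>, which allows the two to be combined; here p^(m+1) comes from
  the triangular exponent of p.\<close>

lemma baskakov_basis_order_step: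
  assumes x: "x \<ge> 0"
  shows "baskakov_basis p q (Suc (Suc m)) k x * (pq_num p q (Suc m) * (p ^ Suc (m + k) + q ^ Suc (m + k) * x))
    = baskakov_basis p q (Suc m) k x * (pq_num p q (Suc (m + k)) * p ^ Suc m)"
proof -
  define T where "T = q ^ (k * (k - 1) div 2)"
  define D where "D = p ^ Suc (m + k) + q ^ Suc (m + k) * x"
  define P where "P = pq_power p q (Suc (m + k)) x"
  define U where "U = p ^ (k + Suc m * m div 2)"
  define U' where "U' = p ^ (k + Suc (Suc m) * Suc m div 2)"
  have "D > 0" unfolding D_def using p_pos q_pos x by (intro add_pos_nonneg) auto
  moreover have "P > 0" unfolding P_def by (rule pq_power_pos[OF x])
  moreover have "pq_fact p q m > 0" "pq_fact p q k > 0" "pq_num p q (Suc m) > 0"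
    by (simp_all add: pq_fact_pos pq_num_pos)
  moreover have "U' = U * p ^ Suc m"
    using triangular_Suc[of "Suc m"] by (simp only: U_def U'_def power_add diff_Suc_1 mult.assoc)
  moreover have "pq_power p q (Suc (Suc m + k)) x = P * D"
    using pq_power_Suc[of "Suc (m + k)" x] by (simp add: P_def D_def)
  moreover have "pq_fact p q (Suc m + k) = pq_fact p q (m + k) * pq_num p q (Suc (m + k))"
    using pq_fact_Suc[of "m + k"] by simp
  ultimately show ?thesis
    unfolding baskakov_basis_Suc pq_fact_Suc[of m]
    unfolding D_def[symmetric] P_def[symmetric] T_def[symmetric] U_def[symmetric] U'_def[symmetric]
    by (simp add: field_simps)
qed

section \<open>Decay and summability of the basis functions\<close>

text \<open>In the exact quotient, [m+k+1] is at most ([m+1] + 1) [k+1], and dropping the term with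
  x from the denominator leaves p^(m+k+1). The quotient thus tends to 0 geometrically, so the basis
  functions decay faster than any geometric sequence.\<close>

lemma baskakov_basis_ratio_bound:
  assumes x: "x \<ge> 0"
  shows "baskakov_basis p q (Suc m) (Suc k) x
    \<le> ((pq_num p q (Suc m) + 1) * x / p ^ m * (q / p) ^ k) * baskakov_basis p q (Suc m) k x"
proof -
  define b b' where "b = baskakov_basis p q (Suc m) k x" and "b' = baskakov_basis p q (Suc m) (Suc k) x"
  define A where "A = pq_num p q (Suc m)"
  define K where "K = pq_num p q (Suc k)"
  have b: "b \<ge> 0" "b' \<ge> 0" by (simp_all add: b_def b'_def baskakov_basis_nonneg x)
  have K: "K > 0" by (simp add: K_def pq_num_pos)
  have A: "A \<ge> 0" by (simp add: A_def pq_num_nonneg)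
  have K2: "K = q ^ k + p * pq_num p q k"
    using pq_num_add[of k 1] by (simp add: K_def)
  have kn: "pq_num p q k \<ge> 0" by (rule pq_num_nonneg)
  have "pq_num p q (Suc (m + k)) = p ^ Suc m * pq_num p q k + q ^ k * A"
    using pq_num_add[of k "Suc m"] by (simp add: A_def add.commute)
  also have "\<dots> \<le> p * pq_num p q k + K * A"
  proof (intro add_mono mult_right_mono kn A)
    show "p ^ Suc m \<le> p" using p_pos p_le by (simp add: mult_left_le power_le_one)
    show "q ^ k \<le> K" using K2 p_pos kn by simp
  qed
  also have "\<dots> \<le> K + K * A" using K2 q_pos by simp
  finally have num: "pq_num p q (Suc (m + k)) \<le> (A + 1) * K" by (simp add: algebra_simps)
  have "(b' * p ^ Suc (m + k)) * K \<le> b' * (K * (p ^ Suc (m + k) + q ^ Suc (m + k) * x))"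
    using b K x q_pos by (simp add: mult_left_mono distrib_left)
  also have "\<dots> = b * (pq_num p q (Suc (m + k)) * p * q ^ k * x)"
    using baskakov_basis_step[OF x, of m k] by (simp add: b_def b'_def K_def)
  also have "\<dots> \<le> b * (((A + 1) * K) * p * q ^ k * x)"
    using b x p_pos q_pos by (intro mult_left_mono mult_right_mono num) auto
  finally have "b' * p ^ Suc (m + k) \<le> b * ((A + 1) * p * q ^ k * x)"
    using K by (simp add: mult_ac)
  then have "b' \<le> b * ((A + 1) * p * q ^ k * x) / p ^ Suc (m + k)"
    using p_pos by (simp add: pos_le_divide_eq)
  also have "\<dots> = ((A + 1) * x / p ^ m * (q / p) ^ k) * b"
    using p_pos by (simp add: field_simps power_add power_divide)
  finally show ?thesis by (simp add: b_def b'_def A_def)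
qed

text \<open>An arbitrary factor \<open>y ^ k\<close> is allowed because the second moments of the
  Jackson laws are bounded only by a multiple of (p/q)^(2k).\<close>

lemma summable_baskakov_basis:
  assumes x: "x \<ge> 0" and y: "y \<ge> 0"
  shows "summable (\<lambda>k. baskakov_basis p q (Suc m) k x * y ^ k)"
proof -
  define c where "c = (pq_num p q (Suc m) + 1) * x / p ^ m * y"
  have "(\<lambda>k. c * (q / p) ^ k) \<longlonglongrightarrow> c * 0"
    using ratio by (intro tendsto_intros LIMSEQ_realpow_zero) auto
  then have "eventually (\<lambda>k. c * (q / p) ^ k < 1 / 2) sequentially"
    by (rule order_tendstoD) simp
  then obtain N where N: "c * (q / p) ^ k < 1 / 2" if "k \<ge> N" for k
    by (auto simp: eventually_at_top_linorder)
  show ?thesis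
  proof (rule summable_ratio_test[of "1 / 2" N])
    fix k assume k: "k \<ge> N"
    let ?b = "\<lambda>k. baskakov_basis p q (Suc m) k x"
    have nn: "?b k * y ^ k \<ge> 0" for k using baskakov_basis_nonneg[OF x] y by simp
    have "?b (Suc k) * y ^ Suc k \<le> (((pq_num p q (Suc m) + 1) * x / p ^ m * (q / p) ^ k) * ?b k) * y ^ Suc k"
      using baskakov_basis_ratio_bound[OF x] y by (intro mult_right_mono) auto
    also have "\<dots> = (c * (q / p) ^ k) * (?b k * y ^ k)" by (simp add: c_def)
    also have "\<dots> \<le> 1 / 2 * (?b k * y ^ k)"
      using N[OF k] nn by (intro mult_right_mono) auto
    finally show "norm (?b (Suc k) * y ^ Suc k) \<le> 1 / 2 * norm (?b k * y ^ k)"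
      using nn[of "Suc k"] nn[of k] by simp
  qed simp
qed

section \<open>Normalisation of the basis by telescoping\<close>

text \<open>Expressions of this form are the remainders of the two telescoping sums below.\<close>

lemma baskakov_basis_tail:
  assumes x: "x \<ge> 0"
  shows "(\<lambda>k. baskakov_basis p q (Suc m) k x * ((q / p) ^ (c + k) * x)) \<longlonglongrightarrow> 0"
proof -
  have "(\<lambda>k. baskakov_basis p q (Suc m) k x) \<longlonglongrightarrow> 0"
    using summable_baskakov_basis[OF x, of 1 m] by (simp add: summable_LIMSEQ_zero)
  moreover have "(\<lambda>k. (q / p) ^ k) \<longlonglongrightarrow> 0"
    using ratio by (intro LIMSEQ_realpow_zero) auto
  then have "(\<lambda>k. (q / p) ^ (k + c)) \<longlonglongrightarrow> 0"
    by (rule LIMSEQ_ignore_initial_segment)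
  ultimately have "(\<lambda>k. baskakov_basis p q (Suc m) k x * ((q / p) ^ (k + c) * x)) \<longlonglongrightarrow> 0 * (0 * x)"
    by (intro tendsto_intros)
  then show ?thesis by (simp add: add.commute)
qed

text \<open>Passing from one order to the next changes each partial sum by a single boundary term,
  which tends to 0; this transfers the total mass from order \<open>Suc m\<close> to order
  \<open>Suc (Suc m)\<close>.\<close>

lemma baskakov_basis_telescope:
  assumes x: "x \<ge> 0"
  shows "(\<Sum>k\<le>K. baskakov_basis p q (Suc m) k x - baskakov_basis p q (Suc (Suc m)) k x)
    = baskakov_basis p q (Suc (Suc m)) K x * ((q / p) ^ (Suc m + K) * x)"
proof (induction K)
  case 0
  have "baskakov_basis p q (Suc (Suc m)) 0 x * (p ^ Suc m + q ^ Suc m * x)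
      = baskakov_basis p q (Suc m) 0 x * p ^ Suc m"
    using baskakov_basis_order_step[OF x, of m 0] pq_num_pos[of "Suc m"] by simp
  then show ?case using p_pos by (simp add: field_simps power_divide)
next
  case (Suc K)
  define n where "n = Suc m"
  define b where "b = baskakov_basis p q n (Suc K) x"
  define b1 where "b1 = baskakov_basis p q (Suc n) (Suc K) x"
  define b0 where "b0 = baskakov_basis p q (Suc n) K x"
  define c where "c = baskakov_basis p q n K x"
  define D where "D = p ^ (n + K) + q ^ (n + K) * x"
  define P Q where "P = p ^ (n + K)" and "Q = q ^ (n + K)"
  have P: "P > 0" using p_pos by (simp add: P_def)
  define A where "A = pq_num p q n"
  have A: "A > 0" by (simp add: A_def n_def pq_num_pos)
  have D: "D > 0" unfolding D_def using p_pos q_pos x by (intro add_pos_nonneg) auto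
  have s: "b * (pq_num p q (Suc K) * D) = c * (pq_num p q (n + K) * p * q ^ K * x)"
    using baskakov_basis_step[OF x, of m K] by (simp add: b_def c_def D_def n_def)
  have o0: "b0 * (A * D) = c * (pq_num p q (n + K) * p ^ n)"
    using baskakov_basis_order_step[OF x, of m K] by (simp add: b0_def c_def D_def n_def A_def)
  have o1: "b1 * (A * (p ^ (n + Suc K) + q ^ (n + Suc K) * x)) = b * (pq_num p q (n + Suc K) * p ^ n)"
    using baskakov_basis_order_step[OF x, of m "Suc K"] by (simp add: b_def b1_def n_def A_def)
  \<comment> \<open>Eliminating \<open>c\<close> between the index step and the order step expresses
    \<open>b\<close> through \<open>b0\<close>.\<close>
  have "(b * pq_num p q (Suc K) * p ^ n) * D = (b0 * A * p * q ^ K * x) * D"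
  proof -
    have "(b * pq_num p q (Suc K) * p ^ n) * D = (b * (pq_num p q (Suc K) * D)) * p ^ n"
      by (simp only: mult_ac)
    also have "\<dots> = (c * (pq_num p q (n + K) * p ^ n)) * (p * q ^ K * x)"
      unfolding s by (simp only: mult_ac)
    also have "\<dots> = (b0 * A * p * q ^ K * x) * D"
      unfolding o0[symmetric] by (simp only: mult_ac)
    finally show ?thesis .
  qed
  then have e: "b * pq_num p q (Suc K) * p ^ n = b0 * A * p * q ^ K * x" using D by simp
  have num: "pq_num p q (n + Suc K) = p ^ Suc K * A + q ^ n * pq_num p q (Suc K)"
    using pq_num_add[of n "Suc K"] by (simp add: A_def)
  \<comment> \<open>Splitting [n+K+1] by \<open>num\<close> leaves one part as a multiple of
    \<open>A\<close> and turns the other into one by \<open>e\<close>, so that \<open>A\<close>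
    cancels.\<close>
  have "(b1 * (p ^ (n + Suc K) + q ^ (n + Suc K) * x)) * A
      = (b * p ^ (n + Suc K) + b0 * p * q ^ (n + K) * x) * A"
  proof -
    have "(b1 * (p ^ (n + Suc K) + q ^ (n + Suc K) * x)) * A = b * (pq_num p q (n + Suc K) * p ^ n)"
      unfolding o1[symmetric] by (simp only: mult_ac)
    also have "\<dots> = b * p ^ (n + Suc K) * A + (b * pq_num p q (Suc K) * p ^ n) * q ^ n"
      by (simp only: num power_add algebra_simps)
    also have "\<dots> = (b * p ^ (n + Suc K) + b0 * p * q ^ (n + K) * x) * A"
      unfolding e by (simp only: power_add algebra_simps)
    finally show ?thesis .
  qed
  then have "b1 * (p ^ (n + Suc K) + q ^ (n + Suc K) * x) = b * p ^ (n + Suc K) + b0 * p * q ^ (n + K) * x"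
    using A by simp
  \<comment> \<open>Divided by \<open>p * P\<close>, this says that the old boundary term plus the
    new summand is the new boundary term.\<close>
  then have h: "b0 * p * Q * x + (b - b1) * (p * P) = b1 * q * Q * x"
    by (simp add: P_def Q_def algebra_simps)
  have "(b0 * (Q / P * x) + (b - b1)) * (p * P) = b0 * p * Q * x + (b - b1) * (p * P)"
    using P by (simp add: distrib_right)
  also have "\<dots> = b1 * (q * Q / (p * P) * x) * (p * P)"
    unfolding h using P p_pos by simp
  finally have "b0 * (Q / P * x) + (b - b1) = b1 * (q * Q / (p * P) * x)"
    by (rule mult_right_cancel[THEN iffD1, rotated]) (use P p_pos in simp)
  then have "b0 * ((q / p) ^ (n + K) * x) + (b - b1) = b1 * ((q / p) ^ (n + Suc K) * x)"
    by (simp add: P_def Q_def power_divide)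
  with Suc.IH show ?case by (simp add: b0_def b1_def b_def n_def)
qed

text \<open>For order 1 the (p,q)-numbers on the two sides of \<open>baskakov_basis_step\<close>
  coincide and cancel, so the partial sums have an explicit defect from 1. This starts the induction
  on the order.\<close>

lemma baskakov_basis_one_partial_sum:
  assumes x: "x \<ge> 0"
  shows "(\<Sum>k\<le>K. baskakov_basis p q (Suc 0) k x) = 1 - baskakov_basis p q (Suc 0) K x * ((q / p) ^ K * x)"
proof (induction K)
  case 0
  show ?case using x by (simp add: baskakov_basis_Suc pq_power_def pq_fact_def field_simps)
next
  case (Suc K)
  have "(baskakov_basis p q (Suc 0) (Suc K) x * (p ^ Suc K + q ^ Suc K * x)) * pq_num p q (Suc K)
      = (baskakov_basis p q (Suc 0) K x * (p * q ^ K * x)) * pq_num p q (Suc K)"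
    using baskakov_basis_step[OF x, of 0 K] by (simp add: mult_ac)
  then have "baskakov_basis p q (Suc 0) (Suc K) x * (p ^ Suc K + q ^ Suc K * x)
      = baskakov_basis p q (Suc 0) K x * (p * q ^ K * x)"
    using pq_num_pos[of "Suc K"] by simp
  then have "baskakov_basis p q (Suc 0) (Suc K) x * (1 + (q / p) ^ Suc K * x)
      = baskakov_basis p q (Suc 0) K x * ((q / p) ^ K * x)"
    using p_pos by (simp add: field_simps power_divide)
  with Suc.IH show ?case by (simp add: algebra_simps)
qed

lemma baskakov_basis_sums_1:
  assumes x: "x \<ge> 0"
  shows "(\<lambda>k. baskakov_basis p q (Suc m) k x) sums 1"
proof (induction m)
  case 0
  have "(\<lambda>K. 1 - baskakov_basis p q (Suc 0) K x * ((q / p) ^ (0 + K) * x)) \<longlonglongrightarrow> 1 - 0"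
    by (intro tendsto_intros baskakov_basis_tail x)
  then show ?case by (simp add: sums_def_le baskakov_basis_one_partial_sum[OF x])
next
  case (Suc m)
  have "(\<lambda>k. baskakov_basis p q (Suc m) k x - baskakov_basis p q (Suc (Suc m)) k x) sums 0"
    unfolding sums_def_le baskakov_basis_telescope[OF x] by (rule baskakov_basis_tail[OF x])
  from sums_diff[OF Suc this] show ?case by simp
qed

end

section \<open>Normalised Jackson weights\<close>

text \<open>The majorant for bilateral Jackson sums, assembled from two geometric series that
  overlap at 0.\<close>

lemma summable_on_geometric_int:
  fixes c :: real
  assumes "0 < c" "c < 1"
  shows "(\<lambda>i::int. c ^ nat \<bar>i\<bar>) summable_on UNIV"
proof -
  have geo: "(\<lambda>n::nat. c ^ n) summable_on UNIV"
    using assms by (subst summable_on_UNIV_nonneg_real_iff) (auto intro: summable_geometric)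
  have 1: "(\<lambda>i::int. c ^ nat \<bar>i\<bar>) summable_on range int"
    by (subst summable_on_reindex) (simp_all add: o_def geo)
  have 2: "(\<lambda>i::int. c ^ nat \<bar>i\<bar>) summable_on range (\<lambda>n. - int n)"
    by (subst summable_on_reindex) (simp_all add: o_def geo inj_def)
  have "i \<in> range int \<union> range (\<lambda>n. - int n)" for i
    by (cases i rule: int_cases2) simp_all
  then have "range int \<union> range (\<lambda>n. - int n) = UNIV" by blast
  with summable_on_union[OF 1 2] show ?thesis by simp
qed

context pq_parameters
begin

definition jterm :: "nat \<Rightarrow> nat \<Rightarrow> int \<Rightarrow> real" where
  "jterm a N i = ((q / p) powi i) ^ a / pq_power p q N ((q / p) powi i)"

text \<open>For 0 < a < N this is the Beta value \<open>pq_Beta p q a (N - a)\<close> without its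
  factor (p - q) / p^a.\<close>

definition jsum :: "nat \<Rightarrow> nat \<Rightarrow> real" where
  "jsum a N = (\<Sum>\<^sub>\<infinity>i. jterm a N i)"

lemma powi_ratio_pos: "(q / p) powi i > 0"
  by (rule zero_less_power_int) (rule ratio)

lemma jterm_pos: "jterm a N i > 0"
  unfolding jterm_def using powi_ratio_pos by (simp add: pq_power_pos less_imp_le)

lemma pq_power_lower:
  assumes "y \<ge> 0"
  shows "(\<Prod>i<N. q ^ i) \<le> pq_power p q N y" "(\<Prod>i<N. q ^ i) * y ^ N \<le> pq_power p q N y"
proof -
  have "q ^ i \<le> p ^ i + q ^ i * y" for i
  proof -
    have "q ^ i \<le> p ^ i" using q_pos q_less by (intro power_mono) auto
    moreover have "0 \<le> q ^ i * y" using q_pos assms by simp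
    ultimately show ?thesis by linarith
  qed
  then show "(\<Prod>i<N. q ^ i) \<le> pq_power p q N y"
    unfolding pq_power_def using q_pos by (intro prod_mono) simp
  have "(\<Prod>i<N. q ^ i * y) \<le> pq_power p q N y"
    unfolding pq_power_def using q_pos p_pos assms by (intro prod_mono) simp
  then show "(\<Prod>i<N. q ^ i) * y ^ N \<le> pq_power p q N y"
    by (simp add: prod.distrib)
qed

text \<open>With z = (q/p)^i, the term is O(z^a) for i \<ge> 0, where z \<le> 1, and O(z^(a-N)) for
  i < 0, where z \<ge> 1. The conditions 0 < a and a < N give geometric decay at the respective
  ends.\<close>

lemma summable_jterm:
  assumes "0 < a" "a < N"
  shows "jterm a N summable_on UNIV"
proof -
  define c where "c = (\<Prod>i<N. q ^ i)"
  have c: "c > 0" unfolding c_def using q_pos by (intro prod_pos) simp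
  have bound: "jterm a N i \<le> 1 / c * (q / p) ^ nat \<bar>i\<bar>" for i
  proof -
    define z where "z = (q / p) powi i"
    have z: "z > 0" by (simp add: z_def powi_ratio_pos)
    show ?thesis
    proof (cases "i \<ge> 0")
      case True
      then have z2: "z = (q / p) ^ nat \<bar>i\<bar>" by (simp add: z_def power_int_def)
      then have "z \<le> 1" using ratio by (simp add: power_le_one)
      then have "z ^ a \<le> z" using z assms power_decreasing[of 1 a z] by simp
      then have "jterm a N i \<le> z / c"
        unfolding jterm_def z_def[symmetric]
        using z c pq_power_lower(1)[of z N] by (intro frac_le) (auto simp: c_def)
      then show ?thesis using z2 by simp
    next
      case False
      have "inverse z = (q / p) powi (- i)" by (simp only: z_def power_int_minus)
      also have "\<dots> = (q / p) ^ nat \<bar>i\<bar>" using False by (simp add: power_int_def)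
      finally have z2: "inverse z = (q / p) ^ nat \<bar>i\<bar>" .
      then have "inverse z \<le> 1" using ratio by (simp add: power_le_one)
      then have z1: "z \<ge> 1" using z by (simp add: inverse_le_1_iff)
      have "jterm a N i \<le> z ^ a / (c * z ^ N)"
        unfolding jterm_def z_def[symmetric]
        using z c pq_power_lower(2)[of z N] by (intro frac_le) (auto simp: c_def)
      also have "\<dots> \<le> z ^ a / (c * (z ^ a * z))"
      proof (intro divide_left_mono mult_left_mono)
        have "z ^ Suc a \<le> z ^ N" using z1 assms by (intro power_increasing) auto
        then show "z ^ a * z \<le> z ^ N" by (simp add: mult.commute)
      qed (use z c in auto)
      also have "\<dots> = 1 / c * inverse z" using z c by (simp add: field_simps)
      finally show ?thesis using z2 by simp
    qed
  qed
  have "(\<lambda>i. 1 / c * (q / p) ^ nat \<bar>i\<bar>) summable_on UNIV"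
    by (intro summable_on_cmult_right summable_on_geometric_int ratio)
  then show ?thesis
    by (rule summable_on_comparison_test) (rule bound, rule less_imp_le[OF jterm_pos])
qed

lemma jsum_pos: "0 < a \<Longrightarrow> a < N \<Longrightarrow> jsum a N > 0"
proof (rule ccontr)
  assume a: "0 < a" "a < N" and "\<not> jsum a N > 0"
  then have "jterm a N 0 = 0"
    unfolding jsum_def using summable_jterm[OF a]
    by (intro nonneg_infsum_le_0D[of "jterm a N" UNIV]) (auto intro: less_imp_le jterm_pos)
  with jterm_pos[of a N 0] show False by simp
qed

text \<open>Expressing \<open>jsum a N\<close> through the two sums below in two ways, directly and after shifting the
  summation index by one, yields their relation.\<close>

lemma jsum_recurrence:
  assumes a: "0 < a" "a < N"
  shows "jsum (Suc a) (Suc N) * ((q / p) ^ a - (q / p) ^ N) = jsum a (Suc N) * (1 - (q / p) ^ a)"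
proof -
  define A B where "A = jsum a (Suc N)" and "B = jsum (Suc a) (Suc N)"
  have sA: "(jterm a (Suc N) has_sum A) UNIV" and sB: "(jterm (Suc a) (Suc N) has_sum B) UNIV"
    unfolding A_def B_def jsum_def using a
    by (auto intro!: has_sum_infsum summable_jterm)
  have e1: "jterm a N i = p ^ N * jterm a (Suc N) i + q ^ N * jterm (Suc a) (Suc N) i" for i
  proof -
    define z where "z = (q / p) powi i"
    have z: "z > 0" by (simp add: z_def powi_ratio_pos)
    have "pq_power p q N z > 0" "p ^ N + q ^ N * z > 0"
      using z p_pos q_pos by (simp_all add: pq_power_pos add_pos_pos)
    then show ?thesis
      unfolding jterm_def z_def[symmetric] pq_power_Suc
      by (simp add: divide_simps) (simp add: algebra_simps)
  qed
  have e2: "jterm a N (i + 1)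
      = (q / p) ^ a * p ^ N * (jterm a (Suc N) i + jterm (Suc a) (Suc N) i)" for i
  proof -
    define z where "z = (q / p) powi i"
    have z: "z > 0" by (simp add: z_def powi_ratio_pos)
    have z': "(q / p) powi (i + 1) = q / p * z"
      using ratio by (subst power_int_add) (auto simp: z_def)
    define R where "R = p ^ N * pq_power p q N (q / p * z)"
    \<comment> \<open>The sum of the two terms carries the same factor 1 + z in its numerator, which
      therefore cancels.\<close>
    have "pq_power p q (Suc N) z = (1 + z) * R" by (simp only: pq_power_scale R_def mult.assoc)
    then have "jterm a (Suc N) i + jterm (Suc a) (Suc N) i = z ^ a * (1 + z) / ((1 + z) * R)"
      unfolding jterm_def z_def[symmetric] by (simp add: add_divide_distrib[symmetric] algebra_simps)
    also have "\<dots> = z ^ a / R" using z by simp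
    finally show ?thesis
      unfolding jterm_def z' R_def using p_pos by (simp add: power_mult_distrib power_divide)
  qed
  have "(jterm a N has_sum p ^ N * A + q ^ N * B) UNIV"
    unfolding e1 by (intro has_sum_add has_sum_cmult_right sA sB)
  then have 1: "jsum a N = p ^ N * A + q ^ N * B"
    unfolding jsum_def by (rule infsumI)
  have "((\<lambda>i. jterm a N (i + 1)) has_sum (q / p) ^ a * p ^ N * (A + B)) UNIV"
    unfolding e2 by (intro has_sum_add has_sum_cmult_right sA sB)
  moreover have "bij_betw (\<lambda>i::int. i + 1) UNIV UNIV"
    by (rule bij_betwI[where g="\<lambda>i. i - 1"]) auto
  ultimately have "jsum a N = (q / p) ^ a * p ^ N * (A + B)"
    unfolding jsum_def using infsum_reindex_bij_betw[of "\<lambda>i::int. i + 1" UNIV UNIV "jterm a N"]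
    by (simp add: infsumI)
  with 1 have "p ^ N * A + q ^ N * B = (q / p) ^ a * p ^ N * (A + B)" by simp
  then have "A + (q / p) ^ N * B = (q / p) ^ a * (A + B)"
    using p_pos by (simp add: field_simps power_divide)
  then show ?thesis by (simp add: A_def B_def algebra_simps)
qed

text \<open>With Q = q/p, the recurrence gives the quotient (1 - Q^a) / (Q^a - Q^N); its numerator
  is at most 1, and N \<ge> a + 1 bounds its denominator below by Q^a (1 - Q).\<close>

lemma jsum_Suc_le:
  assumes a: "0 < a" "a < N"
  shows "jsum (Suc a) (Suc N) \<le> jsum a (Suc N) / ((q / p) ^ a * (1 - q / p))"
proof -
  let ?Q = "q / p"
  have Qa: "?Q ^ a > 0" "1 - ?Q > 0" using ratio by simp_all
  have A: "jsum a (Suc N) > 0" "jsum (Suc a) (Suc N) > 0" using a by (auto intro!: jsum_pos)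
  have "?Q ^ N \<le> ?Q ^ Suc a" using a ratio by (intro power_decreasing) auto
  then have "?Q ^ a * (1 - ?Q) \<le> ?Q ^ a - ?Q ^ N" by (simp add: algebra_simps)
  then have "jsum (Suc a) (Suc N) * (?Q ^ a * (1 - ?Q)) \<le> jsum (Suc a) (Suc N) * (?Q ^ a - ?Q ^ N)"
    using A by (intro mult_left_mono) auto
  also have "\<dots> \<le> jsum a (Suc N)"
    unfolding jsum_recurrence[OF a] using A Qa by (simp add: mult_left_le)
  finally show ?thesis
    using Qa by (subst pos_le_divide_eq) (auto intro: mult_pos_pos)
qed

section \<open>The law of the sampling point for a fixed basis index\<close>

text \<open>The argument q^2 p^(n+k) t of \<open>f\<close> at the Jackson point t = q^i /
  p^(i+1).\<close>

definition node :: "nat \<Rightarrow> nat \<Rightarrow> int \<Rightarrow> real" where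
  "node n k i = q\<^sup>2 * p ^ (n + k) * ((q / p) powi i / p)"

text \<open>The Jackson weights of the integral in the \<open>k\<close>-th summand, divided by
  \<open>pq_Beta p q (k + 1) n\<close>; the common factor (p - q) / p^(k+1) has cancelled.\<close>

definition prob :: "nat \<Rightarrow> nat \<Rightarrow> int \<Rightarrow> real" where
  "prob n k i = jterm (k + 1) (n + k + 1) i / jsum (k + 1) (n + k + 1)"

lemma node_nonneg: "node n k i \<ge> 0"
  unfolding node_def using p_pos less_imp_le[OF powi_ratio_pos] by simp

lemma prob_pos: "n > 0 \<Longrightarrow> prob n k i > 0"
  unfolding prob_def by (intro divide_pos_pos jterm_pos jsum_pos) auto

lemma prob_has_sum_1:
  assumes "n > 0"
  shows "(prob n k has_sum 1) UNIV"
proof -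
  have "(jterm (k + 1) (n + k + 1) has_sum jsum (k + 1) (n + k + 1)) UNIV"
    unfolding jsum_def using assms by (intro has_sum_infsum summable_jterm) auto
  from has_sum_cmult_left[OF this, of "1 / jsum (k + 1) (n + k + 1)"]
  show ?thesis using jsum_pos[of "k + 1" "n + k + 1"] assms by (simp add: prob_def[abs_def])
qed

text \<open>Two more powers of the node turn \<open>jsum (k + 1)\<close> into
  \<open>jsum (k + 3)\<close>, and \<open>jsum_Suc_le\<close> is applied twice. Convergence requires
  k + 3 < n + k + 1, which is exactly n > 2.\<close>

lemma prob_second_moment:
  assumes n: "n > 2"
  obtains e where "((\<lambda>i. prob n k i * (node n k i)\<^sup>2) has_sum e) UNIV"
    "e \<le> 1 / ((q / p) ^ 3 * (1 - q / p)\<^sup>2) * ((p / q)\<^sup>2) ^ k"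
proof
  let ?Q = "q / p"
  define r where "r = q\<^sup>2 * p ^ (n + k) / p"
  define S where "S = jsum (k + 1) (n + k + 1)"
  define T where "T = jsum (k + 3) (n + k + 1)"
  have S: "S > 0" and T: "T > 0" unfolding S_def T_def using n by (auto intro!: jsum_pos)
  have r: "0 \<le> r" "r \<le> 1"
  proof -
    show "0 \<le> r" using p_pos by (simp add: r_def)
    have "p ^ (n + k) \<le> p" using p_pos p_le n power_decreasing[of 1 "n + k" p] by simp
    then have "p ^ (n + k) / p \<le> 1" using p_pos by simp
    moreover have "q\<^sup>2 \<le> 1" using q_pos q_less p_le by (intro power_le_one) auto
    ultimately have "q\<^sup>2 * (p ^ (n + k) / p) \<le> 1"
      using p_pos by (intro mult_le_one) auto
    then show "r \<le> 1" by (simp add: r_def)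
  qed
  have "(jterm (k + 3) (n + k + 1) has_sum T) UNIV"
    unfolding T_def jsum_def using n by (intro has_sum_infsum summable_jterm) auto
  then have "((\<lambda>i. r\<^sup>2 / S * jterm (k + 3) (n + k + 1) i) has_sum r\<^sup>2 / S * T) UNIV"
    by (rule has_sum_cmult_right)
  also have "(\<lambda>i. r\<^sup>2 / S * jterm (k + 3) (n + k + 1) i) = (\<lambda>i. prob n k i * (node n k i)\<^sup>2)"
  proof
    fix i
    define z where "z = ?Q powi i"
    have "node n k i = r * z" by (simp add: node_def r_def z_def)
    moreover have "prob n k i = z ^ (k + 1) / pq_power p q (n + k + 1) z / S"
      by (simp add: prob_def jterm_def z_def S_def)
    moreover have "jterm (k + 3) (n + k + 1) i = z ^ (k + 1) * z\<^sup>2 / pq_power p q (n + k + 1) z"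
      by (simp add: jterm_def z_def power_add[symmetric] eval_nat_numeral)
    ultimately show "r\<^sup>2 / S * jterm (k + 3) (n + k + 1) i = prob n k i * (node n k i)\<^sup>2"
      by (simp add: power_mult_distrib mult_ac)
  qed
  finally show "((\<lambda>i. prob n k i * (node n k i)\<^sup>2) has_sum r\<^sup>2 / S * T) UNIV" .
  have exponent: "k + 1 + (k + 2) = 3 + 2 * k" by simp
  have c: "?Q > 0" "1 - ?Q > 0" using ratio by simp_all
  have "T \<le> jsum (k + 2) (n + k + 1) / (?Q ^ (k + 2) * (1 - ?Q))"
    using jsum_Suc_le[of "k + 2" "n + k"] n by (simp add: T_def eval_nat_numeral)
  also have "\<dots> \<le> (S / (?Q ^ (k + 1) * (1 - ?Q))) / (?Q ^ (k + 2) * (1 - ?Q))"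
  proof (rule divide_right_mono)
    show "jsum (k + 2) (n + k + 1) \<le> S / (?Q ^ (k + 1) * (1 - ?Q))"
      using jsum_Suc_le[of "k + 1" "n + k"] n by (simp add: S_def)
    show "0 \<le> ?Q ^ (k + 2) * (1 - ?Q)"
      by (intro less_imp_le mult_pos_pos zero_less_power c)
  qed
  finally have TS: "T \<le> S / (?Q ^ (k + 1) * (1 - ?Q)) / (?Q ^ (k + 2) * (1 - ?Q))" .
  have "r\<^sup>2 / S * T \<le> 1 / S * T"
    using r S T by (intro mult_right_mono divide_right_mono) (auto intro: power_le_one)
  also have "\<dots> \<le> 1 / S * (S / (?Q ^ (k + 1) * (1 - ?Q)) / (?Q ^ (k + 2) * (1 - ?Q)))"
    using TS S by (intro mult_left_mono) auto
  also have "\<dots> = 1 / ((?Q ^ (k + 1) * ?Q ^ (k + 2)) * (1 - ?Q)\<^sup>2)"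
    using S by (simp add: power2_eq_square mult_ac)
  also have "?Q ^ (k + 1) * ?Q ^ (k + 2) = ?Q ^ 3 * (?Q\<^sup>2) ^ k"
    by (simp only: power_add[symmetric] power_mult[symmetric] exponent)
  also have "1 / (?Q ^ 3 * (?Q\<^sup>2) ^ k * (1 - ?Q)\<^sup>2) = 1 / (?Q ^ 3 * (1 - ?Q)\<^sup>2) * ((p / q)\<^sup>2) ^ k"
    by (simp add: power_divide)
  finally show "r\<^sup>2 / S * T \<le> 1 / (?Q ^ 3 * (1 - ?Q)\<^sup>2) * ((p / q)\<^sup>2) ^ k" .
qed

text \<open>The Jackson weight equals its node t = (q/p)^i / p, so it raises the power of t to k +
  1, and p t is a pure power of q/p. Constants leave \<open>infsum\<close> regardless of
  convergence, so \<open>g\<close> is arbitrary.\<close>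

lemma pq_integral_scaled:
  "pq_integral p q (\<lambda>t. t ^ k / pq_power p q N (p * t) * g t)
    = (p - q) / p ^ (k + 1) * (\<Sum>\<^sub>\<infinity>i. jterm (k + 1) N i * g ((q / p) powi i / p))"
proof -
  have nd: "q powi i / p powi (i + 1) = (q / p) powi i / p" for i
    using p_pos by (simp add: power_int_add power_int_divide_distrib)
  have "q powi i / p powi (i + 1) * ((q powi i / p powi (i + 1)) ^ k
        / pq_power p q N (p * (q powi i / p powi (i + 1))) * g (q powi i / p powi (i + 1)))
      = 1 / p ^ (k + 1) * (jterm (k + 1) N i * g ((q / p) powi i / p))" for i
    unfolding nd jterm_def using p_pos by (simp add: power_divide)
  then show ?thesis
    unfolding pq_integral_def by (simp only: infsum_cmult_right') simp
qed

lemma baskakov_beta_eq: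
  assumes "n > 0"
  shows "baskakov_beta p q n f x =
    (\<Sum>k. baskakov_basis p q n k x * (\<Sum>\<^sub>\<infinity>i. prob n k i * f (node n k i)))"
proof -
  have "baskakov_basis p q n k x * (1 / pq_Beta p q (k + 1) n)
        * pq_integral p q (\<lambda>t. t ^ k / pq_power p q (n + k + 1) (p * t) * f (q\<^sup>2 * p ^ (n + k) * t))
      = baskakov_basis p q n k x * (\<Sum>\<^sub>\<infinity>i. prob n k i * f (node n k i))" for k
  proof -
    define S where "S = jsum (k + 1) (n + k + 1)"
    have S: "S > 0" unfolding S_def using assms by (intro jsum_pos) auto
    define I where "I = (\<Sum>\<^sub>\<infinity>i. jterm (k + 1) (n + k + 1) i * f (node n k i))"
    define c where "c = (p - q) / p ^ (k + 1)"
    have c: "c > 0" using p_pos q_less by (simp add: c_def)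
    have "pq_Beta p q (k + 1) n = c * S"
      using pq_integral_scaled[of k "n + k + 1" "\<lambda>_. 1"]
      by (simp add: pq_Beta_def c_def S_def jsum_def add.commute add.left_commute)
    moreover have "pq_integral p q (\<lambda>t. t ^ k / pq_power p q (n + k + 1) (p * t) * f (q\<^sup>2 * p ^ (n + k) * t)) = c * I"
      using pq_integral_scaled[of k "n + k + 1" "\<lambda>t. f (q\<^sup>2 * p ^ (n + k) * t)"]
      unfolding c_def I_def node_def .
    moreover have "(\<Sum>\<^sub>\<infinity>i. prob n k i * f (node n k i)) = 1 / S * I"
      unfolding I_def infsum_cmult_right'[symmetric] by (simp add: prob_def S_def)
    ultimately show ?thesis using c S by simp
  qed
  then show ?thesis by (simp add: baskakov_beta_def)
qed

section \<open>The operator as an expectation\<close>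

text \<open>The joint law of a two-stage choice: \<open>k\<close> by the basis functions at
  \<open>x\<close>, then \<open>i\<close> by \<open>prob n k\<close>.\<close>

definition weight :: "nat \<Rightarrow> real \<Rightarrow> nat \<times> int \<Rightarrow> real" where
  "weight n x = (\<lambda>(k, i). baskakov_basis p q n k x * prob n k i)"

definition point :: "nat \<Rightarrow> nat \<times> int \<Rightarrow> real" where
  "point n = (\<lambda>(k, i). node n k i)"

lemma point_nonneg: "point n j \<ge> 0"
  by (cases j) (simp add: point_def node_nonneg)

lemma weight_nonneg: "weight n x j \<ge> 0" if "n > 0" "x \<ge> 0"
  using that by (cases j; cases n) (auto simp: weight_def baskakov_basis_nonneg less_imp_le prob_pos)

lemma weight_has_sum_1:
  assumes n: "n > 0" and x: "x \<ge> 0"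
  shows "(weight n x has_sum 1) UNIV"
proof -
  obtain m where m: "n = Suc m" using n by (cases n) auto
  let ?b = "\<lambda>k. baskakov_basis p q n k x"
  have b: "?b k \<ge> 0" for k by (simp add: m baskakov_basis_nonneg x)
  have inner: "((\<lambda>i. weight n x (k, i)) has_sum ?b k) UNIV" for k
    using has_sum_cmult_right[OF prob_has_sum_1[OF n], of "?b k" k] by (simp add: weight_def)
  have outer: "(?b has_sum 1) UNIV"
    using b baskakov_basis_sums_1[OF x, of m] by (intro sums_nonneg_imp_has_sum) (auto simp: m)
  have "weight n x summable_on UNIV \<times> UNIV"
    by (rule summable_on_SigmaI[OF inner])
       (use outer in \<open>auto simp: has_sum_imp_summable weight_nonneg[OF n x]\<close>)
  then have "(weight n x has_sum 1) (UNIV \<times> UNIV)"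
    by (rule has_sum_SigmaI[OF inner outer])
  then show ?thesis by simp
qed

text \<open>The conditional second moments grow at most like (p/q)^(2k), which the decay of the
  basis functions absorbs.\<close>

lemma weight_second_moment_summable:
  assumes n: "n > 2" and x: "x \<ge> 0"
  shows "(\<lambda>j. weight n x j * (point n j)\<^sup>2) summable_on UNIV"
proof -
  obtain m where m: "n = Suc m" using n by (cases n) auto
  let ?b = "\<lambda>k. baskakov_basis p q n k x"
  define C where "C = 1 / ((q / p) ^ 3 * (1 - q / p)\<^sup>2)"
  have b: "?b k \<ge> 0" for k by (simp add: m baskakov_basis_nonneg x)
  have "\<exists>e. ((\<lambda>i. prob n k i * (node n k i)\<^sup>2) has_sum e) UNIV \<and> e \<le> C * ((p / q)\<^sup>2) ^ k" for k
    unfolding C_def by (rule prob_second_moment[OF n, of k]) blast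
  then obtain e where e: "\<And>k. ((\<lambda>i. prob n k i * (node n k i)\<^sup>2) has_sum e k) UNIV"
    and e_le: "\<And>k. e k \<le> C * ((p / q)\<^sup>2) ^ k" by metis
  have e0: "e k \<ge> 0" for k
    using e by (rule has_sum_nonneg) (use n in \<open>simp add: less_imp_le[OF prob_pos]\<close>)
  have inner: "((\<lambda>i. weight n x (k, i) * (point n (k, i))\<^sup>2) has_sum ?b k * e k) UNIV" for k
    using has_sum_cmult_right[OF e, of "?b k" k] by (simp add: weight_def point_def mult.assoc)
  have "summable (\<lambda>k. C * (?b k * ((p / q)\<^sup>2) ^ k))"
    unfolding m by (intro summable_mult summable_baskakov_basis x) simp
  then have "(\<lambda>k. C * (?b k * ((p / q)\<^sup>2) ^ k)) summable_on UNIV"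
    using b ratio by (subst summable_on_UNIV_nonneg_real_iff) (auto simp: C_def)
  then have outer: "(\<lambda>k. ?b k * e k) summable_on UNIV"
    by (rule summable_on_comparison_test)
       (use b e0 mult_left_mono[OF e_le b] in \<open>auto simp: mult_ac\<close>)
  have "(\<lambda>j. weight n x j * (point n j)\<^sup>2) summable_on UNIV \<times> UNIV"
    by (rule summable_on_SigmaI[OF inner outer]) (use n x in \<open>auto simp: weight_nonneg\<close>)
  then show ?thesis by simp
qed

text \<open>At most quadratic growth makes the sum over pairs absolutely convergent, so by Fubini
  the iterated sum defining the operator equals it. This covers bounded \<open>f\<close> and the
  functions behind both central moments.\<close>

lemma baskakov_beta_has_sum:
  assumes n: "n > 2" and x: "x \<ge> 0"
    and f: "\<And>t. t \<ge> 0 \<Longrightarrow> \<bar>f t\<bar> \<le> c * (1 + t\<^sup>2)"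
  shows "((\<lambda>j. weight n x j * f (point n j)) has_sum baskakov_beta p q n f x) UNIV"
proof -
  let ?b = "\<lambda>k. baskakov_basis p q n k x"
  let ?g = "\<lambda>k i. ?b k * (prob n k i * f (node n k i))"
  have n0: "n > 0" using n by simp
  have "(\<lambda>j. c * (weight n x j + weight n x j * (point n j)\<^sup>2)) summable_on UNIV"
    using weight_has_sum_1[OF n0 x] weight_second_moment_summable[OF n x]
    by (intro summable_on_cmult_right summable_on_add) (auto simp: has_sum_imp_summable)
  then have "(\<lambda>j. norm (weight n x j * f (point n j))) summable_on UNIV"
  proof (rule Infinite_Sum.abs_summable_on_comparison_test')
    fix j
    have "weight n x j * \<bar>f (point n j)\<bar> \<le> weight n x j * (c * (1 + (point n j)\<^sup>2))"
      by (intro mult_left_mono f point_nonneg weight_nonneg n0 x)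
    then show "norm (weight n x j * f (point n j)) \<le> c * (weight n x j + weight n x j * (point n j)\<^sup>2)"
      using weight_nonneg[OF n0 x, of j] by (simp add: abs_mult algebra_simps)
  qed
  then have summ: "(\<lambda>j. weight n x j * f (point n j)) summable_on UNIV"
    by (rule abs_summable_summable)
  have eq: "(\<lambda>j. weight n x j * f (point n j)) = (\<lambda>(k, i). ?g k i)"
    by (auto simp: weight_def point_def)
  have summ': "(\<lambda>(k, i). ?g k i) summable_on UNIV \<times> UNIV"
    using summ by (simp add: eq)
  have "(\<lambda>k. \<Sum>\<^sub>\<infinity>i. ?g k i) summable_on UNIV"
    by (rule summable_on_Sigma_banach[OF summ'])
  then have "(\<lambda>k. \<Sum>\<^sub>\<infinity>i. ?g k i) sums (\<Sum>\<^sub>\<infinity>k. \<Sum>\<^sub>\<infinity>i. ?g k i)"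
    by (intro has_sum_imp_sums has_sum_infsum)
  then have "baskakov_beta p q n f x = (\<Sum>\<^sub>\<infinity>k. \<Sum>\<^sub>\<infinity>i. ?g k i)"
    unfolding baskakov_beta_eq[OF n0] infsum_cmult_right'[symmetric] by (rule sums_unique[symmetric])
  also have "\<dots> = (\<Sum>\<^sub>\<infinity>j. weight n x j * f (point n j))"
    using infsum_Sigma'_banach[OF summ'] by (simp add: eq)
  finally show ?thesis using summ by simp
qed

text \<open>A vanishing second moment would put all mass at \<open>x\<close>. The index k = 0 is
  used because its basis function is positive even at x = 0; its nodes are positive and those for i
  = 0 and i = 1 differ by the factor q/p.\<close>

lemma central_moment_2_pos:
  assumes n: "n > 2" and x: "x \<ge> 0"
    and sum: "((\<lambda>j. weight n x j * (point n j - x)\<^sup>2) has_sum s) UNIV"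
  shows "s > 0"
proof (rule ccontr)
  assume s: "\<not> s > 0"
  obtain m where m: "n = Suc m" using n by (cases n) auto
  have n0: "n > 0" using n by simp
  have "weight n x (0, i) * (point n (0, i) - x)\<^sup>2 = 0" for i
    by (rule nonneg_infsum_le_0D[of "\<lambda>j. weight n x j * (point n j - x)\<^sup>2" UNIV])
       (use s sum weight_nonneg[OF n0 x] in \<open>auto simp: infsumI has_sum_imp_summable\<close>)
  moreover have "weight n x (0, i) > 0" for i
    unfolding weight_def using prob_pos[OF n0] baskakov_basis_0_pos[OF x] by (simp add: m)
  ultimately have pt: "node n 0 i = x" for i
    by (metis case_prod_conv less_irrefl mult_eq_0_iff point_def right_minus_eq zero_eq_power2)
  have "node n 0 1 = q / p * node n 0 0" by (simp add: node_def)
  with pt have "x = q / p * x" by metis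
  then have "x = 0" using ratio by (metis less_irrefl mult_cancel_right1)
  moreover have "node n 0 0 > 0" using p_pos q_pos by (simp add: node_def)
  ultimately show False using pt by simp
qed

end

section \<open>The error estimate for the operator\<close>

lemma (in pq_parameters) baskakov_beta_approximation:
  assumes n: "n > 2" and x: "x \<ge> 0" and f: "f \<in> C_B"
  shows "\<bar>baskakov_beta p q n f x - f x\<bar>
    \<le> modulus 1 f \<bar>central_moment p q n 1 x\<bar>
      + 10 * modulus 2 f (sqrt (central_moment p q n 2 x + (central_moment p q n 1 x)\<^sup>2))"
proof -
  have n0: "n > 0" using n by simp
  obtain M where M: "\<forall>t\<in>{0..}. \<bar>f t\<bar> \<le> M"
    using f by (auto simp: C_B_def bounded_iff)
  have "\<bar>f t\<bar> \<le> M * (1 + t\<^sup>2)" if "t \<ge> 0" for t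
  proof -
    have M_t: "\<bar>f t\<bar> \<le> M" using M that by simp
    then have "M * 1 \<le> M * (1 + t\<^sup>2)" by (intro mult_left_mono) auto
    with M_t show ?thesis by simp
  qed
  then have F: "((\<lambda>j. weight n x j * f (point n j)) has_sum baskakov_beta p q n f x) UNIV"
    by (rule baskakov_beta_has_sum[OF n x])
  have dev1: "\<bar>t - x\<bar> \<le> (1 + x) * (1 + t\<^sup>2)" if "t \<ge> 0" for t
  proof -
    have "t \<le> 1 + t\<^sup>2" using sum_squares_bound[of t 1] that by simp
    moreover have "0 \<le> x * t\<^sup>2" "0 \<le> t\<^sup>2" using x by simp_all
    moreover have "(1 + x) * (1 + t\<^sup>2) = 1 + t\<^sup>2 + x + x * t\<^sup>2" by (simp add: algebra_simps)
    ultimately show ?thesis using that x by linarith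
  qed
  have dev2: "\<bar>(t - x)\<^sup>2\<bar> \<le> (1 + x\<^sup>2) * (1 + t\<^sup>2)" if "t \<ge> 0" for t
  proof -
    have "(t - x)\<^sup>2 = t\<^sup>2 + x\<^sup>2 - 2 * t * x" by (simp add: power2_eq_square algebra_simps)
    moreover have "0 \<le> t * x" "0 \<le> x\<^sup>2 * t\<^sup>2" using that x by simp_all
    moreover have "(1 + x\<^sup>2) * (1 + t\<^sup>2) = 1 + t\<^sup>2 + x\<^sup>2 + x\<^sup>2 * t\<^sup>2" by (simp add: algebra_simps)
    ultimately have "(t - x)\<^sup>2 \<le> (1 + x\<^sup>2) * (1 + t\<^sup>2)" by linarith
    then show ?thesis by simp
  qed
  have mu1: "((\<lambda>j. weight n x j * (point n j - x)) has_sum central_moment p q n 1 x) UNIV"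
    unfolding central_moment_def power_one_right by (rule baskakov_beta_has_sum[OF n x dev1])
  have mu2: "((\<lambda>j. weight n x j * (point n j - x)\<^sup>2) has_sum central_moment p q n 2 x) UNIV"
    unfolding central_moment_def by (rule baskakov_beta_has_sum[OF n x dev2])
  show ?thesis
    by (rule weighted_mean_bound[OF f x weight_nonneg[OF n0 x] weight_has_sum_1[OF n0 x]
          point_nonneg F mu1 mu2 central_moment_2_pos[OF n x mu2]])
qed

theorem theorem1:
  "\<exists>C::real. C > 0 \<and>
     (\<forall>f \<in> C_B. \<forall>p q x :: real. \<forall>n::nat.
        0 < q \<longrightarrow> q < p \<longrightarrow> p \<le> 1 \<longrightarrow> 0 \<le> x \<longrightarrow> n > 2 \<longrightarrow>
        \<bar>baskakov_beta p q n f x - f x\<bar>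
          \<le> modulus 1 f \<bar>central_moment p q n 1 x\<bar>
            + C * modulus 2 f (sqrt (central_moment p q n 2 x + (central_moment p q n 1 x)\<^sup>2)))"
proof (intro exI[of _ 10] conjI ballI allI impI)
  fix f :: "real \<Rightarrow> real" and p q x :: real and n :: nat
  assume f: "f \<in> C_B" and "0 < q" "q < p" "p \<le> 1" and x: "0 \<le> x" and n: "n > 2"
  then interpret pq_parameters p q by unfold_locales
  show "\<bar>baskakov_beta p q n f x - f x\<bar>
          \<le> modulus 1 f \<bar>central_moment p q n 1 x\<bar>
            + 10 * modulus 2 f (sqrt (central_moment p q n 2 x + (central_moment p q n 1 x)\<^sup>2))"
    by (rule baskakov_beta_approximation[OF n x f])
qed simp

end
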